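(* Let $V\subset\mathbb{R}^n$ be a closed convex cone. A pair $(A,B)\in\mathcal{C}_V^2(\mathbb{R}^n)$ is reduced if and only if $(A,B)$ has the property of translation and $(A,B)$ is a translate of some $0$-minimal pair.
   Context: $\mathcal{C}_V(\mathbb{R}^n)$ is the family of all nonempty closed convex sets $A\subset\mathbb{R}^n$ whose recession cone $\{x\in\mathbb{R}^n \mid x+A\subset A\}$ equals $V$; $\mathcal{C}_V^2(\mathbb{R}^n)=\mathcal{C}_V(\mathbb{R}^n)\times\mathcal{C}_V(\mathbb{R}^n)$. Sums are Minkowski sums ($\mathcal{C}_V(\mathbb{R}^n)$ is closed under Minkowski addition). Pairs $(A,B),(C,D)\in\mathcal{C}_V^2(\mathbb{R}^n)$ are equivalent if $A+D=B+C$; this is an equivalence relation and $[A,B]$ denotes the class (a set of pairs) of $(A,B)$. Pairs are ordered by $(A_1,B_1)\prec(A_2,B_2)$ iff $A_1\subset A_2$ and $B_1\subset B_2$. A pair $(A,B)$ is $0$-minimal if it is a minimal element (with respect to $\prec$) of $\{(C,D)\in[A,B]\mid 0\in D\}$ (in particular $0\in B$). A translate of $(A,B)$ is a pair $(A-x,B-x)$ with $x\in\mathbb{R}^n$. A pair $(A,B)$ (or its class) has the property of translation if any two $0$-minimal pairs in $[A,B]$ are translates of each other. A pair $(A,B)\in\mathcal{C}_V^2(\mathbb{R}^n)$ is reduced if $[A,B]=\{(A+M,B+M)\mid M\in\mathcal{C}_V(\mathbb{R}^n)\}$. *)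

theory Defs
  imports "HOL-Analysis.Analysis" "HOL-Library.Set_Algebras"
begin

(* Throughout, + on sets is the Minkowski sum and x +o A the translate x + A
   (both from Set_Algebras). *)

definition recession_cone :: "'a::euclidean_space set \<Rightarrow> 'a set" where
  "recession_cone A = {x. x +o A \<subseteq> A}"

definition convex_family :: "'a::euclidean_space set \<Rightarrow> 'a set set" where
  "convex_family V = {A. A \<noteq> {} \<and> closed A \<and> convex A \<and> recession_cone A = V}"

definition pair_equiv ::
    "'a::euclidean_space set \<Rightarrow> (('a set \<times> 'a set) \<times> ('a set \<times> 'a set)) set" where
  "pair_equiv V = {((A, B), (C, D)).
     (A, B) \<in> convex_family V \<times> convex_family V \<and>
     (C, D) \<in> convex_family V \<times> convex_family V \<and>
     A + D = B + C}"

definition pair_class ::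
    "'a::euclidean_space set \<Rightarrow> 'a set \<times> 'a set \<Rightarrow> ('a set \<times> 'a set) set" where
  "pair_class V P = pair_equiv V `` {P}"

definition pair_le :: "'a set \<times> 'a set \<Rightarrow> 'a set \<times> 'a set \<Rightarrow> bool" where
  "pair_le P Q \<longleftrightarrow> fst P \<subseteq> fst Q \<and> snd P \<subseteq> snd Q"

(* The first conjunct also forces P to lie in convex_family V \<times> convex_family V. *)
definition zero_minimal :: "'a::euclidean_space set \<Rightarrow> 'a set \<times> 'a set \<Rightarrow> bool" where
  "zero_minimal V P \<longleftrightarrow>
     P \<in> {Q \<in> pair_class V P. 0 \<in> snd Q} \<and>
     (\<forall>R \<in> {Q \<in> pair_class V P. 0 \<in> snd Q}. pair_le R P \<longrightarrow> R = P)"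

definition is_translate :: "'a::euclidean_space set \<times> 'a set \<Rightarrow> 'a set \<times> 'a set \<Rightarrow> bool" where
  "is_translate P Q \<longleftrightarrow> (\<exists>x. P = ((\<lambda>a. a - x) ` fst Q, (\<lambda>b. b - x) ` snd Q))"

definition translation_property :: "'a::euclidean_space set \<Rightarrow> 'a set \<times> 'a set \<Rightarrow> bool" where
  "translation_property V P \<longleftrightarrow>
     (\<forall>Q \<in> pair_class V P. \<forall>R \<in> pair_class V P.
        zero_minimal V Q \<longrightarrow> zero_minimal V R \<longrightarrow> is_translate Q R)"

definition reduced_pair :: "'a::euclidean_space set \<Rightarrow> 'a set \<times> 'a set \<Rightarrow> bool" where
  "reduced_pair V P \<longleftrightarrow>
     P \<in> convex_family V \<times> convex_family V \<and>
     pair_class V P = {(fst P + M, snd P + M) |M. M \<in> convex_family V}"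

end

theory Submission
  imports Defs
begin

text \<open>
  Write \<open>[A, B]\<close> for the class of \<open>(A, B)\<close>. Two facts carry the proof, and both express that
  sets with one common recession cone behave like compact sets under Minkowski addition:
  the order cancellation law \<open>order_cancellation\<close> (\<open>A + M \<subseteq> B + M\<close> implies \<open>A \<subseteq> B\<close>), and
  \<open>ex_zero_minimal_below\<close>: below every pair of \<open>[A, B]\<close> whose second component contains the
  origin lies a 0-minimal pair.

  Suppose that \<open>(A, B)\<close> is reduced, and let \<open>Q = (A + M, B + M)\<close> be any 0-minimal pair in the
  class. As \<open>0 \<in> B + M\<close>, some \<open>m \<in> M\<close> has \<open>0 \<in> m + B\<close>, and the translate \<open>(m + A, m + B)\<close> lies below
  \<open>Q\<close>; by minimality it is \<open>Q\<close>. Hence every 0-minimal pair of the class is a translate of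
  \<open>(A, B)\<close>, and there is at least one.

  Conversely, the property of translation together with a 0-minimal translate of \<open>(A, B)\<close> says
  that every 0-minimal pair of the class is a translate of \<open>(A, B)\<close>. Let \<open>(C, D) \<in> [A, B]\<close>.
  For \<open>d \<in> D\<close> the pair \<open>(C - d, D - d)\<close> has a 0-minimal pair below it, so
  \<open>D\<close> contains a translate of \<open>B\<close> that contains \<open>d\<close>. Thus \<open>D\<close> is a union of translates of
  \<open>B\<close>, which means \<open>D = B + M\<close> where \<open>M\<close> is the set of all \<open>m\<close> with \<open>m + B \<subseteq> D\<close>. From
  \<open>C + B = A + D = (A + M) + B\<close>, cancellation gives \<open>C = A + M\<close>.

  The two carrying facts both rest on \<open>balanced_subsequence\<close>. If \<open>x n \<in> A\<close> and \<open>y n \<in> B\<close> have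
  convergent sums and \<open>x n\<close> runs off to infinity, then a limit direction \<open>v\<close> of \<open>x n\<close> is in \<open>V\<close>,
  and \<open>- v\<close>, being the limit direction of \<open>y n\<close>, is in \<open>V\<close> too. So the only escape is along the
  lineality space \<open>V \<inter> - V\<close>, and keeping \<open>x n\<close> orthogonal to that space restores compactness.
\<close>

section \<open>Recession cones and lineality spaces\<close>

text \<open>
  The segment from a point \<open>a\<close> of \<open>A\<close> to the far point \<open>x n\<close> lies in \<open>A\<close>, and its point at
  parameter \<open>t n\<close> tends to \<open>a + v\<close>.
\<close>

lemma scaled_limit_in_recession_cone:
  fixes A :: "'a::euclidean_space set"
  assumes "closed A" "convex A" "\<And>n. x n \<in> A" "\<And>n. 0 \<le> t n"
    and t: "t \<longlonglongrightarrow> (0::real)" and lim: "(\<lambda>n. t n *\<^sub>R x n) \<longlonglongrightarrow> v"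
  shows "v \<in> recession_cone A"
proof -
  have "v + a \<in> A" if "a \<in> A" for a
  proof -
    have "(\<lambda>n. (1 - t n) *\<^sub>R a + t n *\<^sub>R x n) \<longlonglongrightarrow> (1 - 0) *\<^sub>R a + v"
      by (intro tendsto_intros t lim)
    moreover have "\<forall>\<^sub>F n in sequentially. (1 - t n) *\<^sub>R a + t n *\<^sub>R x n \<in> A"
      using order_tendstoD(2)[OF t, of 1]
      by (simp, elim eventually_mono) (use assms that in \<open>auto intro!: convexD\<close>)
    ultimately have "(1 - 0) *\<^sub>R a + v \<in> A"
      by (intro Lim_in_closed_set[OF \<open>closed A\<close> _ sequentially_bot])
    then show ?thesis by (simp add: add.commute)
  qed
  then show ?thesis
    by (auto simp: recession_cone_def elt_set_plus_def)
qed

lemma add_mem_recession_cone: "v \<in> recession_cone A \<Longrightarrow> a \<in> A \<Longrightarrow> a + v \<in> A"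
  by (auto simp: recession_cone_def elt_set_plus_def add.commute)

lemma multiple_mem_recession_cone:
  assumes "v \<in> recession_cone A" "a \<in> A"
  shows "a + real n *\<^sub>R v \<in> A"
proof (induction n)
  case (Suc n)
  then show ?case
    using add_mem_recession_cone[OF assms(1) Suc] by (simp add: algebra_simps)
qed (use assms in auto)

lemma ray_in_recession_cone:
  assumes "closed A" "convex A" and "\<And>n. a + real n *\<^sub>R v \<in> A"
  shows "v \<in> recession_cone A"
proof (rule scaled_limit_in_recession_cone[OF assms(1,2)])
  show "a + real (Suc n) *\<^sub>R v \<in> A" for n
    by (rule assms(3))
  show "(\<lambda>n. inverse (real (Suc n))) \<longlonglongrightarrow> 0"
    by (rule LIMSEQ_inverse_real_of_nat)
  then have "(\<lambda>n. inverse (real (Suc n)) *\<^sub>R a + v) \<longlonglongrightarrow> 0 *\<^sub>R a + v"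
    by (intro tendsto_intros)
  then show "(\<lambda>n. inverse (real (Suc n)) *\<^sub>R (a + real (Suc n) *\<^sub>R v)) \<longlonglongrightarrow> v"
    by (simp add: scaleR_right_distrib del: of_nat_Suc)
qed auto

text \<open>
  \<open>a + c *\<^sub>R v\<close> lies on the segment between \<open>a\<close> and \<open>a + n *\<^sub>R v\<close> as soon as \<open>n\<close> exceeds \<open>c\<close>.
\<close>

lemma recession_cone_scale:
  assumes "convex A" "v \<in> recession_cone A" "0 \<le> c"
  shows "c *\<^sub>R v \<in> recession_cone A"
proof -
  have "c *\<^sub>R v + a \<in> A" if "a \<in> A" for a
  proof -
    obtain n where n: "c < real n" using reals_Archimedean2 by blast
    have "(1 - c / n) *\<^sub>R a + (c / n) *\<^sub>R (a + real n *\<^sub>R v) \<in> A"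
      using n assms that multiple_mem_recession_cone[OF assms(2) that]
      by (intro convexD) auto
    moreover have "(1 - c / n) *\<^sub>R a + (c / n) *\<^sub>R (a + real n *\<^sub>R v) = c *\<^sub>R v + a"
      using n assms(3) by (simp add: algebra_simps)
    ultimately show ?thesis by simp
  qed
  then show ?thesis by (auto simp: recession_cone_def elt_set_plus_def)
qed

definition lineality :: "'a::euclidean_space set \<Rightarrow> 'a set" where
  "lineality V = V \<inter> uminus ` V"

lemma subspace_lineality:
  assumes "convex A"
  shows "subspace (lineality (recession_cone A))"
proof (rule subspaceI)
  have add: "x + y \<in> recession_cone A"
    if "x \<in> recession_cone A" "y \<in> recession_cone A" for x y
  proof -
    have "a + y + x \<in> A" if "a \<in> A" for a
      by (intro add_mem_recession_cone that \<open>x \<in> _\<close> \<open>y \<in> _\<close>)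
    then show ?thesis
      by (auto simp: recession_cone_def elt_set_plus_def add.commute add.left_commute)
  qed
  have L: "x \<in> lineality (recession_cone A) \<longleftrightarrow> x \<in> recession_cone A \<and> - x \<in> recession_cone A" for x
    by (force simp: lineality_def)
  show "0 \<in> lineality (recession_cone A)"
    by (simp add: L) (simp add: recession_cone_def)
  show "x + y \<in> lineality (recession_cone A)"
    if "x \<in> lineality (recession_cone A)" "y \<in> lineality (recession_cone A)" for x y
    using that add[of x y] add[of "- x" "- y"] by (simp add: L)
  show "c *\<^sub>R x \<in> lineality (recession_cone A)" if "x \<in> lineality (recession_cone A)" for c x
    using that recession_cone_scale[OF assms, of x c] recession_cone_scale[OF assms, of "- x" c]
      recession_cone_scale[OF assms, of x "- c"] recession_cone_scale[OF assms, of "- x" "- c"]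
    by (cases "0 \<le> c") (auto simp: L)
qed

lemma convex_familyD:
  assumes "A \<in> convex_family V"
  shows "A \<noteq> {}" "closed A" "convex A" "recession_cone A = V"
  using assms by (auto simp: convex_family_def)

lemma add_lineality:
  assumes "A \<in> convex_family V" "a \<in> A" "l \<in> lineality V"
  shows "a + l \<in> A" "a - l \<in> A"
  using assms add_mem_recession_cone[of l A a] add_mem_recession_cone[of "- l" A a]
  by (auto simp: lineality_def convex_family_def)

text \<open>
  Members of the family are invariant under shifts along the lineality space, so each of their
  points can be moved, within the set, into its orthogonal complement.
\<close>

lemma shift_to_lineality_complement:
  assumes "A \<in> convex_family V"
  obtains l where "l \<in> lineality V" "x + l \<in> orthogonal_comp (lineality V)"
proof -
  have sub: "subspace (lineality V)"
    using subspace_lineality[of A] convex_familyD[OF assms] by simp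
  obtain y z where "y \<in> span (lineality V)" "\<And>w. w \<in> span (lineality V) \<Longrightarrow> orthogonal z w" "x = y + z"
    using orthogonal_subspace_decomp_exists[of "lineality V" x] by blast
  moreover have "span (lineality V) = lineality V"
    using sub by (simp add: span_eq_iff)
  ultimately show ?thesis
    using that[of "- y"] sub by (auto simp: orthogonal_comp_def orthogonal_commute subspace_neg)
qed

section \<open>Compactness modulo the lineality space\<close>

text \<open>
  A substitute for compactness of \<open>A\<close>: an unbounded \<open>x\<close> would have a limit direction \<open>v\<close>, and
  since \<open>x n + y n\<close> stays bounded, \<open>y\<close> would recede in direction \<open>- v\<close>. Then both \<open>v\<close> and
  \<open>- v\<close> belong to \<open>V\<close>, so \<open>v\<close> is a unit vector that lies in the lineality space and is
  orthogonal to it.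
\<close>

lemma balanced_subsequence:
  fixes x y :: "nat \<Rightarrow> 'a::euclidean_space"
  assumes A: "A \<in> convex_family V" and B: "B \<in> convex_family V"
    and x: "\<And>n. x n \<in> A" "\<And>n. x n \<in> orthogonal_comp (lineality V)"
    and y: "\<And>n. y n \<in> B" and z: "(\<lambda>n. x n + y n) \<longlonglongrightarrow> z"
  obtains a r where "strict_mono (r::nat \<Rightarrow> nat)" "(x \<circ> r) \<longlonglongrightarrow> a" "a \<in> A" "z - a \<in> B"
proof -
  have "bounded (range x)"
  proof (rule ccontr)
    assume "\<not> bounded (range x)"
    then have "\<exists>n. real (Suc k) < norm (x n)" for k
      by (auto simp: bounded_iff not_le)
    then obtain f where f: "\<And>k. real (Suc k) < norm (x (f k))" by metis
    define t where "t k = inverse (norm (x (f k)))" for k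
    have nz: "x (f k) \<noteq> 0" for k using f[of k] by auto
    have t0: "t \<longlonglongrightarrow> 0"
    proof (rule tendsto_sandwich[OF _ _ tendsto_const LIMSEQ_inverse_real_of_nat])
      show "\<forall>\<^sub>F k in sequentially. 0 \<le> t k" by (simp add: t_def)
      show "\<forall>\<^sub>F k in sequentially. t k \<le> inverse (real (Suc k))"
        using f by (intro always_eventually allI) (auto simp: t_def simp del: of_nat_Suc intro!: less_imp_le less_imp_inverse_less)
    qed
    have "\<forall>k. t k *\<^sub>R x (f k) \<in> sphere 0 1"
      using nz by (simp add: t_def)
    then obtain v s where v: "v \<in> sphere 0 1" and s: "strict_mono (s::nat \<Rightarrow> nat)"
      and lim: "((\<lambda>k. t k *\<^sub>R x (f k)) \<circ> s) \<longlonglongrightarrow> v"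
      by (rule seq_compactE[OF compact_imp_seq_compact[OF compact_sphere]])
    have ts: "(\<lambda>k. t (s k)) \<longlonglongrightarrow> 0"
      using LIMSEQ_subseq_LIMSEQ[OF t0 s] by (simp add: o_def)
    have limx: "(\<lambda>k. t (s k) *\<^sub>R x (f (s k))) \<longlonglongrightarrow> v"
      using lim by (simp add: o_def)
    have "bounded (range (\<lambda>n. x n + y n))"
      using z convergent_imp_bounded by blast
    then obtain K where K: "\<And>n. norm (x n + y n) \<le> K" by (auto simp: bounded_iff)
    have "(\<lambda>k. t (s k) *\<^sub>R (x (f (s k)) + y (f (s k)))) \<longlonglongrightarrow> 0"
    proof (rule Lim_null_comparison)
      show "\<forall>\<^sub>F k in sequentially. norm (t (s k) *\<^sub>R (x (f (s k)) + y (f (s k)))) \<le> t (s k) * K"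
        using K by (intro always_eventually allI) (auto simp: t_def intro!: mult_left_mono)
      show "(\<lambda>k. t (s k) * K) \<longlonglongrightarrow> 0"
        using tendsto_mult_left_zero[OF ts] by blast
    qed
    from tendsto_diff[OF this limx]
    have limy: "(\<lambda>k. t (s k) *\<^sub>R y (f (s k))) \<longlonglongrightarrow> - v"
      by (simp add: scaleR_right_distrib)
    have "v \<in> V"
      using scaled_limit_in_recession_cone[OF convex_familyD(2,3)[OF A] x(1) _ ts limx] convex_familyD(4)[OF A]
      by (auto simp: t_def)
    moreover have "- v \<in> V"
      using scaled_limit_in_recession_cone[OF convex_familyD(2,3)[OF B] y _ ts limy] convex_familyD(4)[OF B]
      by (auto simp: t_def)
    ultimately have vL: "v \<in> lineality V" by (force simp: lineality_def)
    have "(t (s k) *\<^sub>R x (f (s k))) \<bullet> v = 0" for k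
      using x(2)[of "f (s k)"] vL
      by (auto simp: orthogonal_comp_def orthogonal_def inner_commute)
    moreover have "(\<lambda>k. (t (s k) *\<^sub>R x (f (s k))) \<bullet> v) \<longlonglongrightarrow> v \<bullet> v"
      by (intro tendsto_intros limx)
    ultimately have "v \<bullet> v = 0" by (simp only: LIMSEQ_const_iff)
    then show False using v by simp
  qed
  then obtain a r where r: "strict_mono (r::nat \<Rightarrow> nat)" and a: "(x \<circ> r) \<longlonglongrightarrow> a"
    using bounded_imp_convergent_subsequence by blast
  have "a \<in> A"
    by (rule closed_sequentially[OF convex_familyD(2)[OF A] _ a]) (simp add: x)
  moreover have "(\<lambda>n. y (r n)) \<longlonglongrightarrow> z - a"
    using tendsto_diff[OF LIMSEQ_subseq_LIMSEQ[OF z r] a] by (simp add: o_def)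
  then have "z - a \<in> B"
    by (rule closed_sequentially[OF convex_familyD(2)[OF B], rotated]) (simp add: y)
  ultimately show ?thesis using that r a by blast
qed

text \<open>
  The component of the first summand along the lineality space can be handed over to the
  second summand; this provides the orthogonality that \<open>balanced_subsequence\<close> asks for.
\<close>

lemma split_in_lineality_complement:
  assumes A: "A \<in> convex_family V" and B: "B \<in> convex_family V" and "z \<in> A + B"
  obtains a b where "a \<in> A" "a \<in> orthogonal_comp (lineality V)" "b \<in> B" "z = a + b"
proof -
  obtain a b where ab: "a \<in> A" "b \<in> B" "z = a + b"
    using assms(3) by (auto elim: set_plus_elim)
  obtain l where l: "l \<in> lineality V" "a + l \<in> orthogonal_comp (lineality V)"
    using shift_to_lineality_complement[OF A] by blast
  show ?thesis
    using that[of "a + l" "b - l"] add_lineality[OF A ab(1) l(1)] add_lineality[OF B ab(2) l(1)] ab l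
    by simp
qed

section \<open>Cancellation and closure under addition\<close>

text \<open>
  For compact \<open>M\<close> the classical argument iterates \<open>a + m n = b n + m (n + 1)\<close> and averages:
  \<open>a\<close> is the mean of \<open>b 0, \<dots>, b n\<close> plus \<open>(m (n + 1) - m 0) / (n + 1)\<close>, and the last term vanishes
  in the limit. Here \<open>M\<close> is unbounded and that term need not vanish, but
  \<open>balanced_subsequence\<close> makes it converge along a subsequence, and its limit is a
  recession direction of \<open>M\<close>. So \<open>a\<close> is a point of \<open>B\<close> plus an element of \<open>V\<close>, hence in \<open>B\<close>.
\<close>

lemma order_cancellation:
  fixes A B M :: "'a::euclidean_space set"
  assumes B: "B \<in> convex_family V" and M: "M \<in> convex_family V" and le: "A + M \<subseteq> B + M"
  shows "A \<subseteq> B"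
proof
  fix a assume a: "a \<in> A"
  let ?N = "M \<inter> orthogonal_comp (lineality V)"
  have step: "\<exists>m'\<in>?N. \<exists>b\<in>B. a + m = b + m'" if "m \<in> ?N" for m
  proof -
    have "a + m \<in> M + B"
      using le a that by (auto simp: add.commute intro: set_plus_intro)
    then show ?thesis
      using split_in_lineality_complement[OF M B] by (metis IntI add.commute)
  qed
  have "M + M \<noteq> {}" using convex_familyD(1)[OF M] by (auto intro: set_plus_intro)
  then obtain m0 where m0: "m0 \<in> ?N"
    using split_in_lineality_complement[OF M M] by (metis IntI all_not_in_conv)
  have "\<exists>m. \<forall>n. m n \<in> ?N \<and> (\<exists>b\<in>B. a + m n = b + m (Suc n))"
    by (rule dependent_nat_choice) (use m0 step in blast)+
  then obtain m where m: "\<And>n. m n \<in> ?N" and "\<And>n. \<exists>b\<in>B. a + m n = b + m (Suc n)"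
    by blast
  then obtain b where b: "\<And>n. b n \<in> B" "\<And>n. a + m n = b n + m (Suc n)" by metis
  define t where "t n = inverse (real (Suc n))" for n
  have t0: "t \<longlonglongrightarrow> 0" unfolding t_def by (rule LIMSEQ_inverse_real_of_nat)
  have t: "0 \<le> t n" "t n \<le> 1" "t n * real (Suc n) = 1" for n
    by (auto simp: t_def field_simps)
  \<comment> \<open>Dividing by \<open>n + 1\<close> leaves \<open>M\<close>; adding \<open>(1 - t n) *\<^sub>R m 0\<close> turns the remainder into the
      convex combination \<open>p n\<close>, to which the compactness argument applies.\<close>
  define p where "p n = (1 - t n) *\<^sub>R m 0 + t n *\<^sub>R m (Suc n)" for n
  define q where "q n = (\<Sum>k\<le>n. t n *\<^sub>R b k)" for n
  have p: "p n \<in> M" "p n \<in> orthogonal_comp (lineality V)" for n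
    using m t convexD[OF convex_familyD(3)[OF M], of "m 0" "m (Suc n)" "1 - t n" "t n"]
    unfolding p_def
    by (auto intro!: subspace_add subspace_scale subspace_orthogonal_comp)
  have q: "q n \<in> B" for n
    unfolding q_def using t b(1) convex_familyD(3)[OF B]
    by (intro convex_sum) (auto simp: mult.commute)
  have sum: "(\<Sum>k\<le>n. b k) + m (Suc n) = real (Suc n) *\<^sub>R a + m 0" for n
  proof (induction n)
    case (Suc n)
    have "(\<Sum>k\<le>Suc n. b k) + m (Suc (Suc n)) = (\<Sum>k\<le>n. b k) + (b (Suc n) + m (Suc (Suc n)))"
      by (simp add: add.assoc)
    also have "\<dots> = a + ((\<Sum>k\<le>n. b k) + m (Suc n))"
      by (simp flip: b(2) add: add_ac)
    also have "\<dots> = real (Suc (Suc n)) *\<^sub>R a + m 0"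
      unfolding Suc.IH by (simp add: algebra_simps scaleR_2)
    finally show ?case .
  qed (use b(2)[of 0] in simp)
  have const: "p n + q n = a + m 0" for n
  proof -
    have "p n + q n = (1 - t n) *\<^sub>R m 0 + t n *\<^sub>R ((\<Sum>k\<le>n. b k) + m (Suc n))"
      by (simp add: p_def q_def scaleR_right_distrib scaleR_sum_right)
    also have "\<dots> = (1 - t n) *\<^sub>R m 0 + (t n * real (Suc n)) *\<^sub>R a + t n *\<^sub>R m 0"
      by (simp only: sum) (simp add: scaleR_right_distrib)
    also have "\<dots> = a + m 0" by (simp only: t) (simp add: algebra_simps)
    finally show ?thesis .
  qed
  have lim: "(\<lambda>n. p n + q n) \<longlonglongrightarrow> a + m 0" by (simp add: const)
  obtain c r where r: "strict_mono (r::nat \<Rightarrow> nat)" "(p \<circ> r) \<longlonglongrightarrow> c"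
    and "c \<in> M" and c: "a + m 0 - c \<in> B"
    by (rule balanced_subsequence[OF M B p q lim])
  have tr: "(\<lambda>n. t (r n)) \<longlonglongrightarrow> 0" using LIMSEQ_subseq_LIMSEQ[OF t0 r(1)] by (simp add: o_def)
  have "(\<lambda>n. (p \<circ> r) n - (1 - t (r n)) *\<^sub>R m 0) \<longlonglongrightarrow> c - (1 - 0) *\<^sub>R m 0"
    by (intro tendsto_intros r tr)
  then have "(\<lambda>n. t (r n) *\<^sub>R m (Suc (r n))) \<longlonglongrightarrow> c - m 0" by (simp add: p_def)
  then have "c - m 0 \<in> recession_cone M"
    using scaled_limit_in_recession_cone[OF convex_familyD(2,3)[OF M] _ _ tr, of "\<lambda>n. m (Suc (r n))"] m t
    by auto
  then show "a \<in> B"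
    using add_mem_recession_cone[OF _ c, of "c - m 0"] convex_familyD(4)[OF M] convex_familyD(4)[OF B] by simp
qed

text \<open>
  Closedness is \<open>balanced_subsequence\<close>. A vector \<open>v\<close> with \<open>v + (A + B) \<subseteq> A + B\<close> satisfies
  \<open>v + A \<subseteq> A\<close> by cancelling \<open>B\<close>, so the sum has no new recession directions.
\<close>

lemma convex_family_sum:
  assumes A: "A \<in> convex_family V" and B: "B \<in> convex_family V"
  shows "A + B \<in> convex_family V"
proof -
  have cl: "closed (A + B)"
    unfolding closed_sequential_limits
  proof (intro allI impI, elim conjE)
    fix w z
    assume w: "\<forall>n. w n \<in> A + B" "w \<longlonglongrightarrow> z"
    have "\<exists>a b. a \<in> A \<and> a \<in> orthogonal_comp (lineality V) \<and> b \<in> B \<and> w n = a + b" for n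
      using split_in_lineality_complement[OF A B] w(1) by metis
    then obtain x y where xy: "\<And>n. x n \<in> A" "\<And>n. x n \<in> orthogonal_comp (lineality V)"
      "\<And>n. y n \<in> B" "\<And>n. w n = x n + y n" by metis
    have lim: "(\<lambda>n. x n + y n) \<longlonglongrightarrow> z" using w(2) by (simp flip: xy(4))
    obtain a r where "strict_mono (r::nat \<Rightarrow> nat)" "(x \<circ> r) \<longlonglongrightarrow> a" "a \<in> A" "z - a \<in> B"
      by (rule balanced_subsequence[OF A B xy(1-3) lim])
    then show "z \<in> A + B" using set_plus_intro[of a A "z - a" B] by simp
  qed
  have cv: "convex (A + B)"
    using A B by (simp add: convex_familyD convex_set_plus)
  have "V \<subseteq> recession_cone (A + B)"
  proof
    fix v assume "v \<in> V"
    then have "a + b + v \<in> A + B" if "a \<in> A" "b \<in> B" for a b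
      using that add_mem_recession_cone[of v B b] convex_familyD(4)[OF B] set_plus_intro[of a A "b + v" B]
      by (simp add: add.assoc)
    then show "v \<in> recession_cone (A + B)"
      by (auto simp: recession_cone_def elt_set_plus_def set_plus_def add.commute)
  qed
  moreover have "recession_cone (A + B) \<subseteq> V"
  proof
    fix v assume v: "v \<in> recession_cone (A + B)"
    then have "(v +o A) + B \<subseteq> A + B"
      by (simp add: recession_cone_def set_plus_rearrange3)
    then show "v \<in> V"
      using order_cancellation[OF A B] convex_familyD(4)[OF A] by (auto simp: recession_cone_def)
  qed
  ultimately show ?thesis
    using cl cv convex_familyD(1)[OF A] convex_familyD(1)[OF B]
    by (auto simp: convex_family_def set_plus_def)
qed

lemma set_cancellation:
  assumes "A \<in> convex_family V" "B \<in> convex_family V" "M \<in> convex_family V" "A + M = B + M"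
  shows "A = B"
  using order_cancellation[of A V M B] order_cancellation[of B V M A] assms by auto

lemma mem_singleton_plus: "y \<in> {x} + A \<longleftrightarrow> y - x \<in> A" for x :: "'a::ab_group_add"
  by (force simp: set_plus_def)

lemma convex_family_translate:
  assumes "A \<in> convex_family V"
  shows "{x} + A \<in> convex_family V"
proof -
  have "{x} + A = (+) x ` A" by (auto simp: set_plus_def)
  moreover have "recession_cone ((+) x ` A) = recession_cone A"
    by (force simp: recession_cone_def elt_set_plus_def add.left_commute)
  ultimately show ?thesis
    using assms by (auto simp: convex_family_def closed_translation convex_translation)
qed

section \<open>Intersections\<close>

text \<open>
  The recession cone of an intersection can only grow. It does not exceed \<open>V\<close> because a ray in a
  nonempty intersection is a ray in each member, and one contained ray already gives a recession
  direction of a closed convex set.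
\<close>

lemma convex_family_Inter:
  assumes "F \<noteq> {}" "F \<subseteq> convex_family V" "\<Inter>F \<noteq> {}"
  shows "\<Inter>F \<in> convex_family V"
proof -
  have "V \<subseteq> recession_cone (\<Inter>F)"
    using assms(2) by (fastforce simp: convex_family_def recession_cone_def elt_set_plus_def)
  moreover have "recession_cone (\<Inter>F) \<subseteq> V"
  proof
    fix v assume v: "v \<in> recession_cone (\<Inter>F)"
    obtain a D where "a \<in> \<Inter>F" "D \<in> F" using assms by blast
    with multiple_mem_recession_cone[OF v] have "a + real n *\<^sub>R v \<in> D" for n by blast
    with \<open>D \<in> F\<close> assms(2) show "v \<in> V"
      using ray_in_recession_cone[of D a v] by (auto simp: convex_family_def)
  qed
  ultimately show ?thesis
    using assms by (auto simp: convex_family_def intro!: closed_Inter convex_Inter)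
qed

text \<open>
  This is what makes the classes closed under intersections of chains. For \<open>z\<close> on the right, the
  points \<open>w \<in> D\<close> with \<open>z - w \<in> A\<close> that are orthogonal to the lineality space form a compact
  nonempty set for each \<open>D\<close>, and these sets are nested along the chain, so a single \<open>w\<close> serves
  all \<open>D\<close>.
\<close>

lemma sum_Inter_chain:
  assumes A: "A \<in> convex_family V" and F: "F \<noteq> {}" "F \<subseteq> convex_family V"
    and chain: "\<And>S T. S \<in> F \<Longrightarrow> T \<in> F \<Longrightarrow> S \<subseteq> T \<or> T \<subseteq> S"
  shows "A + \<Inter>F = (\<Inter>D\<in>F. A + D)"
proof
  show "A + \<Inter>F \<subseteq> (\<Inter>D\<in>F. A + D)"
    by (auto simp: set_plus_def)
  show "(\<Inter>D\<in>F. A + D) \<subseteq> A + \<Inter>F"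
  proof
    fix z assume z: "z \<in> (\<Inter>D\<in>F. A + D)"
    define K where "K D = {w \<in> D. w \<in> orthogonal_comp (lineality V) \<and> z - w \<in> A}" for D
    have compact: "compact (K D)" if "D \<in> F" for D
      unfolding compact_def
    proof (intro allI impI)
      fix w :: "nat \<Rightarrow> 'a" assume "\<forall>n. w n \<in> K D"
      then have w: "\<And>n. w n \<in> D" "\<And>n. w n \<in> orthogonal_comp (lineality V)" "\<And>n. z - w n \<in> A"
        by (auto simp: K_def)
      have D: "D \<in> convex_family V" using that F by blast
      have lim: "(\<lambda>n. w n + (z - w n)) \<longlonglongrightarrow> z" by simp
      obtain a r where ar: "strict_mono (r::nat \<Rightarrow> nat)" "(w \<circ> r) \<longlonglongrightarrow> a" "a \<in> D" "z - a \<in> A"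
        by (rule balanced_subsequence[OF D A w lim])
      moreover have "a \<in> orthogonal_comp (lineality V)"
        by (rule closed_sequentially[OF closed_subspace[OF subspace_orthogonal_comp] _ ar(2)]) (simp add: w)
      ultimately show "\<exists>l\<in>K D. \<exists>r. strict_mono r \<and> (w \<circ> r) \<longlonglongrightarrow> l"
        unfolding K_def by blast
    qed
    have nonempty: "K D \<noteq> {}" if "D \<in> F" for D
    proof -
      have D: "D \<in> convex_family V" using that F by blast
      have zDA: "z \<in> D + A" using z that by (auto simp: add.commute)
      obtain w a where "w \<in> D" "w \<in> orthogonal_comp (lineality V)" "a \<in> A" "z = w + a"
        by (rule split_in_lineality_complement[OF D A zDA])
      then have "w \<in> K D" by (simp add: K_def)
      then show ?thesis by blast
    qed
    have "\<Inter>(K ` F) \<noteq> {}"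
    proof (rule compact_chain)
      show "S \<subseteq> T \<or> T \<subseteq> S" if "S \<in> K ` F \<and> T \<in> K ` F" for S T
        using that chain unfolding K_def by blast
    qed (use compact nonempty in auto)
    then obtain w where "\<And>D. D \<in> F \<Longrightarrow> w \<in> K D" by blast
    then have "w \<in> \<Inter>F" "z - w \<in> A" using F(1) by (auto simp: K_def)
    then show "z \<in> A + \<Inter>F" using set_plus_intro[of "z - w" A w] by simp
  qed
qed

section \<open>Equivalence classes and translates\<close>

lemma mem_pair_class:
  "(C, D) \<in> pair_class V (A, B) \<longleftrightarrow>
    A \<in> convex_family V \<and> B \<in> convex_family V \<and> C \<in> convex_family V \<and> D \<in> convex_family V \<and> A + D = B + C"
  by (auto simp: pair_class_def pair_equiv_def)

lemma pair_class_refl: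
  assumes "A \<in> convex_family V" "B \<in> convex_family V"
  shows "(A, B) \<in> pair_class V (A, B)"
  using assms by (simp add: mem_pair_class add.commute)

text \<open>
  Adding both equations gives \<open>A + F\<close> and \<open>B + E\<close> up to the common summand \<open>C + D\<close>, which
  the cancellation law removes.
\<close>

lemma pair_class_trans:
  assumes "(C, D) \<in> pair_class V (A, B)" "(E, F) \<in> pair_class V (C, D)"
  shows "(E, F) \<in> pair_class V (A, B)"
proof -
  have 1: "A + D = B + C" "C + F = D + E" using assms by (auto simp: mem_pair_class)
  have "(A + F) + (C + D) = (A + D) + (C + F)" by (simp add: add_ac)
  also have "\<dots> = (B + E) + (C + D)" unfolding 1 by (simp add: add_ac)
  finally have eq: "(A + F) + (C + D) = (B + E) + (C + D)" .
  have "A + F = B + E"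
    by (rule set_cancellation[OF _ _ _ eq]) (use assms in \<open>auto simp: mem_pair_class intro!: convex_family_sum\<close>)
  then show ?thesis using assms by (simp add: mem_pair_class)
qed

lemma pair_class_eq:
  assumes "Q \<in> pair_class V P"
  shows "pair_class V Q = pair_class V P"
proof -
  obtain A B C D where [simp]: "P = (A, B)" "Q = (C, D)" by (metis surj_pair)
  have "(A, B) \<in> pair_class V (C, D)"
    using assms by (simp add: mem_pair_class add.commute)
  then show ?thesis
    using assms pair_class_trans by auto
qed

lemma translate_mem_pair_class:
  assumes "(C, D) \<in> pair_class V P"
  shows "({x} + C, {x} + D) \<in> pair_class V P"
proof -
  obtain A B where P: "P = (A, B)" by (cases P)
  have "A + ({x} + D) = B + ({x} + C)"
    using assms by (simp add: P mem_pair_class add.left_commute[of _ "{x}"])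
  then show ?thesis
    using assms by (simp add: P mem_pair_class convex_family_translate)
qed

lemma is_translate_iff: "is_translate P Q \<longleftrightarrow> (\<exists>x. P = ({x} + fst Q, {x} + snd Q))"
proof -
  have "(\<lambda>a. a - x) ` S = {- x} + S" for x and S :: "'a::euclidean_space set"
    by (force simp: mem_singleton_plus)
  then have "is_translate P Q \<longleftrightarrow> (\<exists>x. P = ({- x} + fst Q, {- x} + snd Q))"
    by (simp add: is_translate_def)
  then show ?thesis by (metis minus_minus)
qed

lemma singleton_plus_assoc: "{x} + ({y} + S) = {x + y} + S" for x :: "'a::comm_monoid_add"
proof -
  have "{x} + {y} = {x + y}" by (simp add: set_plus_def)
  then show ?thesis by (simp flip: add.assoc)
qed

lemma is_translate_sym:
  assumes "is_translate P Q"
  shows "is_translate Q P"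
proof -
  obtain x where "P = ({x} + fst Q, {x} + snd Q)"
    using assms by (auto simp: is_translate_iff)
  then have "Q = ({- x} + fst P, {- x} + snd P)"
    by (simp add: singleton_plus_assoc prod_eq_iff flip: set_zero)
  then show ?thesis unfolding is_translate_iff by blast
qed

lemma is_translate_trans: "is_translate P Q \<Longrightarrow> is_translate Q R \<Longrightarrow> is_translate P R"
  by (auto simp: is_translate_iff singleton_plus_assoc)

section \<open>Existence of 0-minimal pairs\<close>

text \<open>
  Zorn's lemma for the reversed order: the lower bound of a chain is its componentwise
  intersection. It is equivalent to \<open>P\<close> by \<open>sum_Inter_chain\<close>. The second components share the
  origin; the first components then have a common point because of the equation between the sums.
\<close>

lemma ex_zero_minimal_below:
  assumes CD: "(C, D) \<in> pair_class V P" "0 \<in> D"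
  obtains Q where "Q \<in> pair_class V P" "zero_minimal V Q" "pair_le Q (C, D)"
proof -
  obtain A B where P: "P = (A, B)" by (cases P)
  have A: "A \<in> convex_family V" and B: "B \<in> convex_family V"
    using CD by (auto simp: P mem_pair_class)
  define S where "S = {Q \<in> pair_class V P. 0 \<in> snd Q \<and> pair_le Q (C, D)}"
  have po: "partial_order_on S (relation_of (\<lambda>Q R. pair_le R Q) S)"
    by (rule partial_order_on_relation_ofI) (auto simp: pair_le_def)
  have bound: "\<exists>u\<in>S. \<forall>Q\<in>H. pair_le u Q" if H: "H \<in> Chains (relation_of (\<lambda>Q R. pair_le R Q) S)" for H
  proof (cases "H = {}")
    case True
    have "(C, D) \<in> S" using CD by (simp add: S_def pair_le_def)
    with True show ?thesis by blast
  next
    case False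
    have HS: "H \<subseteq> S" and comp: "\<And>Q R. Q \<in> H \<Longrightarrow> R \<in> H \<Longrightarrow> pair_le Q R \<or> pair_le R Q"
      using H by (auto simp: Chains_def relation_of_def)
    have Hc: "fst Q \<in> convex_family V" "snd Q \<in> convex_family V" "A + snd Q = B + fst Q" "0 \<in> snd Q"
      "pair_le Q (C, D)" if "Q \<in> H" for Q
      using that HS by (cases Q; auto simp: S_def P mem_pair_class)+
    have chain: "S \<subseteq> T \<or> T \<subseteq> S" if "S \<in> fst ` H \<and> T \<in> fst ` H \<or> S \<in> snd ` H \<and> T \<in> snd ` H" for S T
      using that comp unfolding pair_le_def by blast
    have sub: "fst ` H \<subseteq> convex_family V" "snd ` H \<subseteq> convex_family V" "fst ` H \<noteq> {}" "snd ` H \<noteq> {}"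
      using Hc False by auto
    have eq: "A + \<Inter>(snd ` H) = B + \<Inter>(fst ` H)"
    proof -
      have "A + \<Inter>(snd ` H) = (\<Inter>D\<in>snd ` H. A + D)"
        by (rule sum_Inter_chain[OF A sub(4,2) chain]) blast
      also have "\<dots> = (\<Inter>C\<in>fst ` H. B + C)" using Hc(3) by simp
      also have "\<dots> = B + \<Inter>(fst ` H)"
        by (rule sum_Inter_chain[OF B sub(3,1) chain, symmetric]) blast
      finally show ?thesis .
    qed
    have zero: "0 \<in> \<Inter>(snd ` H)" using Hc(4) by blast
    then have "A + \<Inter>(snd ` H) \<noteq> {}" using convex_familyD(1)[OF A] set_plus_intro by blast
    then have "\<Inter>(fst ` H) \<noteq> {}" unfolding eq by (auto simp: set_plus_def)
    then have "\<Inter>(fst ` H) \<in> convex_family V" "\<Inter>(snd ` H) \<in> convex_family V"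
      using zero convex_family_Inter[OF sub(3,1)] convex_family_Inter[OF sub(4,2)] by blast+
    moreover have "pair_le (\<Inter>(fst ` H), \<Inter>(snd ` H)) (C, D)"
      using Hc(5) False unfolding pair_le_def by fastforce
    ultimately have "(\<Inter>(fst ` H), \<Inter>(snd ` H)) \<in> S"
      using eq zero A B by (simp add: S_def P mem_pair_class)
    then show ?thesis by (rule bexI[rotated]) (simp add: pair_le_def INF_lower)
  qed
  obtain Q where Q: "Q \<in> S" and min: "\<And>R. R \<in> S \<Longrightarrow> pair_le R Q \<Longrightarrow> R = Q"
    using predicate_Zorn[OF po bound] by blast
  have "R = Q" if "R \<in> pair_class V P" "0 \<in> snd R" "pair_le R Q" for R
  proof (rule min)
    show "R \<in> S" using that Q unfolding S_def pair_le_def by blast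
  qed (rule that(3))
  moreover have "Q \<in> pair_class V P" "0 \<in> snd Q" using Q by (simp_all add: S_def)
  ultimately have "zero_minimal V Q"
    unfolding zero_minimal_def using pair_class_eq[of Q V P] by blast
  then show ?thesis using that[of Q] Q by (simp add: S_def)
qed

section \<open>Reduced pairs\<close>

text \<open>
  In \<open>Q = (A + M, B + M)\<close> the origin is \<open>b + m\<close>, so \<open>m + B\<close> already contains it. The
  translate of \<open>P\<close> by \<open>m\<close> therefore competes with \<open>Q\<close> and lies below it.
\<close>

lemma reduced_pair_zero_minimal_translate:
  assumes red: "reduced_pair V P" and Q: "Q \<in> pair_class V P" "zero_minimal V Q"
  shows "is_translate Q P"
proof -
  obtain A B where P: "P = (A, B)" by (cases P)
  obtain M where M: "M \<in> convex_family V" "Q = (A + M, B + M)"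
    using red Q(1) by (auto simp: reduced_pair_def P)
  have "0 \<in> B + M" using Q(2) M by (simp add: zero_minimal_def)
  then obtain b m where bm: "b \<in> B" "m \<in> M" "0 = b + m" by (auto elim: set_plus_elim)
  let ?T = "({m} + A, {m} + B)"
  have "(A, B) \<in> pair_class V P"
    unfolding P by (rule pair_class_refl) (use red in \<open>auto simp: reduced_pair_def P\<close>)
  then have "?T \<in> pair_class V Q"
    using translate_mem_pair_class pair_class_eq[OF Q(1)] by metis
  moreover have "0 \<in> {m} + B"
    using bm(1) set_plus_intro[of m "{m}" b B] by (simp add: bm(3) add.commute)
  moreover have "pair_le ?T Q"
    using bm(2) by (auto simp: pair_le_def M set_plus_def add.commute)
  ultimately have "?T = Q" using Q(2) by (simp add: zero_minimal_def)
  then show ?thesis by (auto simp: is_translate_iff P)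
qed

text \<open>
  The complementary summand is the Minkowski difference of \<open>D\<close> and \<open>B\<close>, the set of all
  \<open>m\<close> with \<open>m + B \<subseteq> D\<close>. Written as an intersection of translates of \<open>D\<close>, it inherits
  closedness, convexity and the recession cone.
\<close>

lemma summand_of_translate_cover:
  assumes B: "B \<in> convex_family V" and D: "D \<in> convex_family V"
    and cover: "\<And>d. d \<in> D \<Longrightarrow> \<exists>x. d \<in> {x} + B \<and> {x} + B \<subseteq> D"
  obtains M where "M \<in> convex_family V" "D = B + M"
proof -
  define M where "M = (\<Inter>b\<in>B. {- b} + D)"
  have M: "m \<in> M \<longleftrightarrow> {m} + B \<subseteq> D" for m
    unfolding M_def INT_iff mem_singleton_plus by (auto simp: set_plus_def add.commute)
  have eq: "D = B + M"
  proof
    show "D \<subseteq> B + M"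
    proof
      fix d assume "d \<in> D"
      then obtain x where "d \<in> {x} + B" "x \<in> M" using cover M by blast
      then show "d \<in> B + M" by (auto simp: set_plus_def add.commute)
    qed
    show "B + M \<subseteq> D" by (auto simp: M_def mem_singleton_plus add.commute elim!: set_plus_elim)
  qed
  moreover have "M \<in> convex_family V"
    unfolding M_def
  proof (rule convex_family_Inter)
    show "\<Inter>((\<lambda>b. {- b} + D) ` B) \<noteq> {}"
      using eq convex_familyD(1)[OF D] by (auto simp: M_def set_plus_def)
  qed (use convex_familyD(1)[OF B] convex_family_translate[OF D] in auto)
  ultimately show ?thesis using that by blast
qed

text \<open>
  A 0-minimal pair below \<open>(C - d, D - d)\<close> is a translate of \<open>(A, B)\<close>, and shifting back by
  \<open>d\<close> gives a translate of \<open>B\<close> inside \<open>D\<close> through \<open>d\<close>. Covering \<open>D\<close> in this way makes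
  \<open>B\<close> a summand of \<open>D\<close>; cancellation transfers the summand to \<open>C\<close>.
\<close>

lemma reduced_pair_if_all_zero_minimal_translates:
  assumes A: "A \<in> convex_family V" and B: "B \<in> convex_family V"
    and tr: "\<And>Q. Q \<in> pair_class V (A, B) \<Longrightarrow> zero_minimal V Q \<Longrightarrow> is_translate Q (A, B)"
  shows "reduced_pair V (A, B)"
proof -
  have "\<exists>M\<in>convex_family V. C = A + M \<and> D = B + M" if CD: "(C, D) \<in> pair_class V (A, B)" for C D
  proof -
    have C: "C \<in> convex_family V" and D: "D \<in> convex_family V" and eq: "A + D = B + C"
      using CD by (auto simp: mem_pair_class)
    have "\<exists>x. d \<in> {x} + B \<and> {x} + B \<subseteq> D" if "d \<in> D" for d
    proof -
      have "({- d} + C, {- d} + D) \<in> pair_class V (A, B)" "0 \<in> {- d} + D"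
        using translate_mem_pair_class[OF CD] that by (auto simp: mem_singleton_plus)
      then obtain Q where Q: "Q \<in> pair_class V (A, B)" "zero_minimal V Q" "pair_le Q ({- d} + C, {- d} + D)"
        using ex_zero_minimal_below by metis
      then obtain y where y: "Q = ({y} + A, {y} + B)" using tr[OF Q(1,2)] by (auto simp: is_translate_iff)
      have "0 \<in> {y} + B" "{y} + B \<subseteq> {- d} + D"
        using Q(2,3) by (simp_all add: y zero_minimal_def pair_le_def)
      \<comment> \<open>Points are written as \<open>z + d\<close>, so that membership in \<open>{- d} + D\<close> reads off
          directly.\<close>
      then have "0 + d \<in> {d + y} + B" "z + d \<in> {d + y} + B \<Longrightarrow> z + d \<in> D" for z
        by (auto simp: mem_singleton_plus subset_iff)
      then have "d \<in> {d + y} + B \<and> {d + y} + B \<subseteq> D"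
        by (metis add_0 diff_add_cancel subsetI)
      then show ?thesis by blast
    qed
    then obtain M where M: "M \<in> convex_family V" "D = B + M"
      using summand_of_translate_cover[OF B D] by blast
    have "C + B = (A + M) + B" using eq M by (simp add: add_ac)
    then have "C = A + M"
      using set_cancellation C B A M convex_family_sum by blast
    then show ?thesis using M by blast
  qed
  moreover have "(A + M, B + M) \<in> pair_class V (A, B)" if "M \<in> convex_family V" for M
    using that A B by (simp add: mem_pair_class convex_family_sum add_ac)
  ultimately show ?thesis
    using A B unfolding reduced_pair_def by force
qed

theorem theorem3p3:
  fixes V A B :: "(real ^ 'n) set"
  assumes "closed V" and "convex V" and "cone V"
    and "(A, B) \<in> convex_family V \<times> convex_family V"
  shows "reduced_pair V (A, B) \<longleftrightarrow>
    translation_property V (A, B) \<and>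
    (\<exists>P. zero_minimal V P \<and> is_translate (A, B) P)"
proof
  have A: "A \<in> convex_family V" and B: "B \<in> convex_family V" using assms by auto
  have self: "(A, B) \<in> pair_class V (A, B)" by (rule pair_class_refl[OF A B])
  {
    assume red: "reduced_pair V (A, B)"
    note tr = reduced_pair_zero_minimal_translate[OF red]
    have "translation_property V (A, B)"
      unfolding translation_property_def using tr is_translate_sym is_translate_trans by blast
    moreover obtain b where "b \<in> B" using convex_familyD(1)[OF B] by blast
    then have "0 \<in> {- b} + B" by (simp add: mem_singleton_plus)
    then obtain Q where "Q \<in> pair_class V (A, B)" "zero_minimal V Q"
      using ex_zero_minimal_below[OF translate_mem_pair_class[OF self]] by metis
    ultimately show "translation_property V (A, B) \<and> (\<exists>P. zero_minimal V P \<and> is_translate (A, B) P)"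
      using tr is_translate_sym by blast
  }
  assume R: "translation_property V (A, B) \<and> (\<exists>P. zero_minimal V P \<and> is_translate (A, B) P)"
  then obtain P where P: "zero_minimal V P" "is_translate (A, B) P" by blast
  then obtain x where "P = ({x} + A, {x} + B)"
    using is_translate_sym[OF P(2)] by (auto simp: is_translate_iff)
  then have "P \<in> pair_class V (A, B)" using translate_mem_pair_class[OF self] by simp
  then have "is_translate Q P" if "Q \<in> pair_class V (A, B)" "zero_minimal V Q" for Q
    using R P(1) that unfolding translation_property_def by simp
  then have "is_translate Q (A, B)" if "Q \<in> pair_class V (A, B)" "zero_minimal V Q" for Q
    using that is_translate_trans[OF _ is_translate_sym[OF P(2)]] by simp
  then show "reduced_pair V (A, B)"
    by (rule reduced_pair_if_all_zero_minimal_translates[OF A B])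
qed

end
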